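(* Let $\Theta=\{\theta_1<\dots<\theta_K\}\subset\mathbb{R}_+$. For any $w\in\mathcal{R}$ and any $\mu\in\Delta(\Theta)$ with full support, the problem $$\max_{\sigma\in\Sigma(\mu)}\ \sum_{(\theta,p)\in\Theta\times P}w(\theta,p)\,\sigma(\theta,p)$$ has an optimal solution that belongs to $\Sigma^\star(\mu)$.
   Context: Setting. $\Theta=\{\theta_1<\dots<\theta_K\}\subset\mathbb{R}_+$ is a finite set (buyer types) and $P=\Theta$ (prices). $\Delta(X)$ is the set of probability distributions on a finite set $X$. The market $\mu\in\Delta(\Theta)$ satisfies $\mu(\theta)>0$ for all $\theta\in\Theta$. Segmentations. $\Sigma(\mu)$ is the set of $\sigma\in\Delta(\Theta\times P)$ such that $\sum_{p\in P}\sigma(\theta,p)=\mu(\theta)$ for all $\theta\in\Theta$ and (obedience) for all $p,q\in P$, $p\sum_{\theta\ge p}\sigma(\theta,p)\ge q\sum_{\theta\ge q}\sigma(\theta,p)$. Let $\Omega=\{(\theta,p)\in\Theta\times P:\theta\ge p\}$ and $\Sigma^\star(\mu)=\{\sigma\in\Sigma(\mu):\operatorname{supp}(\sigma)\subseteq\Omega\}$ (efficient segmentations). Redistributive welfare functions. $\mathcal{R}$ is the set of $w:\Theta\times P\to\mathbb{R}$ such that: $w(\theta,p)=0$ if $\theta<p$ and $w(\theta,p)\ge0$ if $\theta\ge p$; for each $k$, $p\mapsto w(\theta_k,p)$ is non-increasing on $\{\theta_1,\dots,\theta_k\}$; and for all $\theta,\theta'\in\Theta$ and $p,p'\in P$ with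 $\theta'>\theta\ge p'>p$, $w(\theta,p)-w(\theta,p')\ge w(\theta',p)-w(\theta',p')$. *)

theory Defs
  imports "HOL-Probability.Probability_Mass_Function"
begin

definition dists :: "'a set \<Rightarrow> 'a pmf set"
  where "dists X = {m. set_pmf m \<subseteq> X}"

text \<open>
  Throughout, \<open>\<Theta>\<close> is both the set of buyer types and the set of prices (\<open>P = \<Theta>\<close>), and the
  first component of a pair is the type, the second the price.
\<close>

definition segmentations :: "real set \<Rightarrow> real pmf \<Rightarrow> (real \<times> real) pmf set"
  where "segmentations \<Theta> \<mu> =
    {\<sigma> \<in> dists (\<Theta> \<times> \<Theta>).
       (\<forall>\<theta>\<in>\<Theta>. (\<Sum>p\<in>\<Theta>. pmf \<sigma> (\<theta>, p)) = pmf \<mu> \<theta>) \<and>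
       (\<forall>p\<in>\<Theta>. \<forall>q\<in>\<Theta>.
          p * (\<Sum>\<theta> | \<theta> \<in> \<Theta> \<and> \<theta> \<ge> p. pmf \<sigma> (\<theta>, p)) \<ge>
          q * (\<Sum>\<theta> | \<theta> \<in> \<Theta> \<and> \<theta> \<ge> q. pmf \<sigma> (\<theta>, p)))}"

definition trade_pairs :: "real set \<Rightarrow> (real \<times> real) set"
  where "trade_pairs \<Theta> = {(\<theta>, p) \<in> \<Theta> \<times> \<Theta>. \<theta> \<ge> p}"

definition efficient_segmentations :: "real set \<Rightarrow> real pmf \<Rightarrow> (real \<times> real) pmf set"
  where "efficient_segmentations \<Theta> \<mu> =
    {\<sigma> \<in> segmentations \<Theta> \<mu>. set_pmf \<sigma> \<subseteq> trade_pairs \<Theta>}"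

text \<open>
  A welfare function is a function on \<open>\<Theta> \<times> \<Theta>\<close>; it is represented by a total function whose
  values elsewhere are unconstrained and never used. For \<open>\<theta> = \<theta>\<^sub>k\<close>, the set
  \<open>{\<theta>\<^sub>1, \<dots>, \<theta>\<^sub>k}\<close> is \<open>{p \<in> \<Theta>. p \<le> \<theta>}\<close>.
\<close>

definition redistributive :: "real set \<Rightarrow> (real \<Rightarrow> real \<Rightarrow> real) set"
  where "redistributive \<Theta> =
    {w. (\<forall>\<theta>\<in>\<Theta>. \<forall>p\<in>\<Theta>. (\<theta> < p \<longrightarrow> w \<theta> p = 0) \<and> (\<theta> \<ge> p \<longrightarrow> w \<theta> p \<ge> 0)) \<and>
        (\<forall>\<theta>\<in>\<Theta>. antimono_on {p \<in> \<Theta>. p \<le> \<theta>} (w \<theta>)) \<and>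
        (\<forall>\<theta>\<in>\<Theta>. \<forall>\<theta>'\<in>\<Theta>. \<forall>p\<in>\<Theta>. \<forall>p'\<in>\<Theta>.
           \<theta>' > \<theta> \<and> \<theta> \<ge> p' \<and> p' > p \<longrightarrow> w \<theta> p - w \<theta> p' \<ge> w \<theta>' p - w \<theta>' p')}"

definition welfare :: "real set \<Rightarrow> (real \<Rightarrow> real \<Rightarrow> real) \<Rightarrow> (real \<times> real) pmf \<Rightarrow> real"
  where "welfare \<Theta> w \<sigma> = (\<Sum>(\<theta>, p)\<in>\<Theta> \<times> \<Theta>. w \<theta> p * pmf \<sigma> (\<theta>, p))"

end

theory Submission
  imports Defs
begin

text \<open>
  Suppose \<open>p\<close> is an optimal price for the market \<open>x\<close>, and let \<open>S\<close> be the support of \<open>x\<close> (without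
  the type \<open>0\<close>, which is put in a segment of its own). Subtract from \<open>x\<close> the largest possible
  multiple of the market on \<open>S\<close> for which all prices in \<open>S\<close> yield the same revenue. This lowers
  the revenue of all prices in \<open>S\<close> by the same amount, so \<open>p\<close> stays optimal, while the support
  shrinks. In the subtracted part, the lowest type of \<open>S\<close> is an optimal price; it serves everybody
  and is at most \<open>p\<close>. Iterating, \<open>x\<close> is split into efficient segments whose prices are at most
  \<open>p\<close>. Applied to every segment of an optimal segmentation, which exists by compactness, this does
  not lower welfare, because \<open>w\<close> is non-negative, decreasing in the price, and zero without trade.
\<close>

section \<open>Revenue of a price in a market and optimality of a price\<close>

definition revenue :: "real set \<Rightarrow> (real \<Rightarrow> real) \<Rightarrow> real \<Rightarrow> real"
  where "revenue \<Theta> x q = q * (\<Sum>\<theta> | \<theta> \<in> \<Theta> \<and> \<theta> \<ge> q. x \<theta>)"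

definition obedient :: "real set \<Rightarrow> (real \<Rightarrow> real) \<Rightarrow> real \<Rightarrow> bool"
  where "obedient \<Theta> x p \<longleftrightarrow> (\<forall>q\<in>\<Theta>. revenue \<Theta> x q \<le> revenue \<Theta> x p)"

lemma revenue_zero: "revenue \<Theta> (\<lambda>_. 0) q = 0"
  by (simp add: revenue_def)

lemma revenue_add: "revenue \<Theta> (\<lambda>\<theta>. x \<theta> + y \<theta>) q = revenue \<Theta> x q + revenue \<Theta> y q"
  by (simp add: revenue_def sum.distrib algebra_simps)

lemma revenue_diff: "revenue \<Theta> (\<lambda>\<theta>. x \<theta> - y \<theta>) q = revenue \<Theta> x q - revenue \<Theta> y q"
  by (simp add: revenue_def sum_subtractf algebra_simps)

lemma revenue_scale: "revenue \<Theta> (\<lambda>\<theta>. a * x \<theta>) q = a * revenue \<Theta> x q"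
  by (simp add: revenue_def flip: sum_distrib_left)

lemma revenue_sum: "revenue \<Theta> (\<lambda>\<theta>. \<Sum>i\<in>I. x i \<theta>) q = (\<Sum>i\<in>I. revenue \<Theta> (x i) q)"
  unfolding revenue_def sum_distrib_left[symmetric] by (subst sum.swap) simp

lemma obedient_add:
  assumes "obedient \<Theta> x p" "obedient \<Theta> y p"
  shows "obedient \<Theta> (\<lambda>\<theta>. x \<theta> + y \<theta>) p"
  using assms unfolding obedient_def revenue_add by (blast intro: add_mono)

lemma obedient_sum:
  assumes "\<And>i. i \<in> I \<Longrightarrow> obedient \<Theta> (x i) p"
  shows "obedient \<Theta> (\<lambda>\<theta>. \<Sum>i\<in>I. x i \<theta>) p"
  unfolding obedient_def revenue_sum
proof (intro ballI sum_mono)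
  show "revenue \<Theta> (x i) q \<le> revenue \<Theta> (x i) p" if "q \<in> \<Theta>" "i \<in> I" for q i
    using assms[OF that(2)] that(1) by (simp add: obedient_def)
qed

lemma revenue_nonneg:
  assumes "0 \<le> q" "\<And>\<theta>. \<theta> \<in> \<Theta> \<Longrightarrow> 0 \<le> x \<theta>"
  shows "0 \<le> revenue \<Theta> x q"
proof -
  have "0 \<le> (\<Sum>\<theta> | \<theta> \<in> \<Theta> \<and> \<theta> \<ge> q. x \<theta>)" using assms(2) by (intro sum_nonneg) blast
  with assms(1) show ?thesis by (simp add: revenue_def)
qed

text \<open>Type 0 buys only at price 0, where revenue is 0 whatever the demand. Hence the mass at 0
  can be removed without affecting obedience.\<close>

lemma revenue_fun_upd_zero:
  assumes "\<Theta> \<subseteq> {0..}" "q \<in> \<Theta>"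
  shows "revenue \<Theta> (x(0 := a)) q = revenue \<Theta> x q"
proof (cases "q = 0")
  case False
  with assms have "0 < q" by force
  then have "(\<Sum>\<theta> | \<theta> \<in> \<Theta> \<and> \<theta> \<ge> q. (x(0 := a)) \<theta>) = (\<Sum>\<theta> | \<theta> \<in> \<Theta> \<and> \<theta> \<ge> q. x \<theta>)"
    by (intro sum.cong) auto
  then show ?thesis by (simp only: revenue_def)
qed (simp add: revenue_def)

text \<open>The witness is the least element of \<open>S\<close> above \<open>q\<close>: no mass
  lies between the two, so they face the same demand. The last equation expresses equal demand
  without dividing by prices; nonzero revenue at \<open>q\<close> ensures that such an element
  exists.\<close>

lemma revenue_next_support:
  assumes "finite \<Theta>" and S: "S \<subseteq> \<Theta>"
    and x0: "\<forall>\<theta>\<in>\<Theta> - S. x \<theta> = 0" and r: "revenue \<Theta> x q \<noteq> 0"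
  obtains s where "s \<in> S" "q \<le> s"
    "q * revenue \<Theta> x s = s * revenue \<Theta> x q"
proof -
  let ?A = "{s \<in> S. q \<le> s}"
  have fin: "finite S" using S assms(1) finite_subset by blast
  have "?A \<noteq> {}"
  proof
    assume e: "?A = {}"
    have "(\<Sum>\<theta> | \<theta> \<in> \<Theta> \<and> \<theta> \<ge> q. x \<theta>) = 0"
      by (rule sum.neutral) (use e x0 in auto)
    with r show False by (simp add: revenue_def)
  qed
  with fin have M: "Min ?A \<in> ?A" by (intro Min_in) auto
  have M2: "Min ?A \<le> t" if "t \<in> ?A" for t using fin that by (intro Min_le) auto
  have eq: "(\<Sum>\<theta> | \<theta> \<in> \<Theta> \<and> \<theta> \<ge> q. x \<theta>) = (\<Sum>\<theta> | \<theta> \<in> \<Theta> \<and> \<theta> \<ge> Min ?A. x \<theta>)"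
  proof (rule sum.mono_neutral_right)
    show "\<forall>\<theta>\<in>{\<theta> \<in> \<Theta>. \<theta> \<ge> q} - {\<theta> \<in> \<Theta>. \<theta> \<ge> Min ?A}. x \<theta> = 0"
      using M2 x0 by fastforce
  qed (use M assms(1) in auto)
  show thesis
    by (rule that[of "Min ?A"]) (use M in \<open>auto simp: revenue_def eq\<close>)
qed

section \<open>Equal-revenue markets\<close>

text \<open>Induction that adds a new lowest type \<open>b\<close>. Revenue at a price depends only
  on the types at or above it, so the revenues already equal to 1 are kept, and the mass of
  \<open>b\<close> is free to be fixed by the condition at price \<open>b\<close>.\<close>

lemma equal_revenue_market:
  fixes S :: "real set"
  assumes "finite S" "S \<subseteq> {0<..}"
  shows "\<exists>e. (\<forall>s\<in>S. 0 < e s) \<and> (\<forall>s. s \<notin> S \<longrightarrow> e s = 0) \<and> (\<forall>s\<in>S. revenue S e s = 1)"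
  using assms
proof (induction S rule: finite_linorder_min_induct)
  case empty
  then show ?case by auto
next
  case (insert b A)
  then have "\<exists>e. (\<forall>s\<in>A. 0 < e s) \<and> (\<forall>s. s \<notin> A \<longrightarrow> e s = 0) \<and> (\<forall>s\<in>A. revenue A e s = 1)"
    by simp
  then obtain e where e: "\<And>s. s \<in> A \<Longrightarrow> 0 < e s" "\<And>s. s \<notin> A \<Longrightarrow> e s = 0"
    "\<And>s. s \<in> A \<Longrightarrow> revenue A e s = 1" by blast
  define D where "D = sum e A"
  \<comment> \<open>At its lowest price the old market sells to everybody with revenue 1, so its
    total mass is \<open>1 / Min A\<close>. This leaves room for a positive mass at the lower type
    \<open>b\<close>.\<close>
  have D: "D < 1 / b"
  proof (cases "A = {}")
    case True
    then show ?thesis using insert by (simp add: D_def)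
  next
    case False
    have m: "Min A \<in> A" "b < Min A" using insert False by auto
    have "revenue A e (Min A) = Min A * D"
      using insert False by (auto simp: revenue_def D_def intro!: sum.cong)
    with e(3) m have "Min A * D = 1" by simp
    moreover have "0 < b" using insert by simp
    ultimately have "D = 1 / Min A" using m(2) by (simp add: field_simps)
    also have "\<dots> < 1 / b" using m(2) \<open>0 < b\<close> by (intro divide_strict_left_mono) auto
    finally show ?thesis .
  qed
  \<comment> \<open>The total mass becomes \<open>1 / b\<close>, which is what revenue 1 at price
    \<open>b\<close> requires.\<close>
  define f where "f = e(b := 1 / b - D)"
  have bA: "b \<notin> A" using insert by auto
  have "revenue (insert b A) f s = 1" if "s \<in> insert b A" for s
  proof (cases "s = b")
    case True
    have "{\<theta> \<in> insert b A. s \<le> \<theta>} = insert b A" using True insert by force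
    then have "revenue (insert b A) f s = b * (f b + sum f A)"
      using True bA insert by (simp add: revenue_def)
    also have "sum f A = D" unfolding D_def f_def using bA by (auto intro: sum.cong)
    also have "b * (f b + D) = 1" using insert.prems by (simp add: f_def)
    finally show ?thesis .
  next
    case False
    then have s: "s \<in> A" "b < s" using that insert by auto
    have "sum f {\<theta> \<in> insert b A. s \<le> \<theta>} = sum e {\<theta> \<in> A. s \<le> \<theta>}"
      using s(2) bA by (intro sum.cong) (auto simp: f_def)
    then have "revenue (insert b A) f s = revenue A e s"
      by (simp only: revenue_def)
    then show ?thesis by (simp only: e(3)[OF s(1)])
  qed
  moreover have "0 < f s" if "s \<in> insert b A" for s
    using that e(1)[of s] D by (auto simp: f_def)
  moreover have "f s = 0" if "s \<notin> insert b A" for s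
    using that e(2)[of s] by (simp add: f_def)
  ultimately show ?case by blast
qed

section \<open>Splitting one segment into efficient segments with lower prices\<close>

text \<open>Here \<open>x\<close> is the market of a segment with price \<open>p\<close>, and
  \<open>g \<theta> q\<close> is the mass of type \<open>\<theta>\<close> moved to the new segment
  with price \<open>q\<close>. The bound \<open>q \<le> \<theta>\<close> is efficiency, and
  \<open>q \<le> p\<close> ensures that nobody faces a higher price.\<close>

definition efficient_split ::
  "real set \<Rightarrow> (real \<Rightarrow> real) \<Rightarrow> real \<Rightarrow> (real \<Rightarrow> real \<Rightarrow> real) \<Rightarrow> bool"
  where "efficient_split \<Theta> x p g \<longleftrightarrow>
    (\<forall>\<theta> q. 0 \<le> g \<theta> q) \<and>
    (\<forall>\<theta> q. g \<theta> q \<noteq> 0 \<longrightarrow> \<theta> \<in> \<Theta> \<and> q \<in> \<Theta> \<and> q \<le> \<theta> \<and> q \<le> p) \<and>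
    (\<forall>\<theta>\<in>\<Theta>. (\<Sum>q\<in>\<Theta>. g \<theta> q) = x \<theta>) \<and>
    (\<forall>q\<in>\<Theta>. obedient \<Theta> (\<lambda>\<theta>. g \<theta> q) q)"

text \<open>The market \<open>z\<close> is merged into column \<open>m\<close> and the other columns
  stay as they are. Adding two markets for which \<open>m\<close> is optimal keeps \<open>m\<close>
  optimal.\<close>

lemma efficient_split_add_segment:
  assumes "finite \<Theta>" "efficient_split \<Theta> y p g" "m \<in> \<Theta>" "m \<le> p" "obedient \<Theta> z m"
    and "\<And>\<theta>. 0 \<le> z \<theta>" "\<And>\<theta>. z \<theta> \<noteq> 0 \<Longrightarrow> \<theta> \<in> \<Theta> \<and> m \<le> \<theta>"
  shows "efficient_split \<Theta> (\<lambda>\<theta>. y \<theta> + z \<theta>) p (\<lambda>\<theta> q. g \<theta> q + (if q = m then z \<theta> else 0))"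
proof -
  have "obedient \<Theta> (\<lambda>\<theta>. g \<theta> q + (if q = m then z \<theta> else 0)) q" if "q \<in> \<Theta>" for q
    using assms that by (cases "q = m") (auto simp: efficient_split_def intro!: obedient_add)
  moreover have "(\<Sum>q\<in>\<Theta>. g \<theta> q + (if q = m then z \<theta> else 0)) = y \<theta> + z \<theta>" if "\<theta> \<in> \<Theta>" for \<theta>
    using assms that by (simp add: efficient_split_def sum.distrib)
  ultimately show ?thesis
    using assms unfolding efficient_split_def
    by (auto split: if_splits) (metis add.right_neutral add.left_neutral)+
qed

text \<open>Strong induction on the number of types with positive mass, with \<open>p\<close> fixed.
  Each step cuts off one obedient segment and removes at least one type from the support.\<close>

lemma efficient_split_exists:
  assumes "finite \<Theta>" "\<Theta> \<subseteq> {0..}" "p \<in> \<Theta>" "\<And>\<theta>. \<theta> \<in> \<Theta> \<Longrightarrow> 0 \<le> x \<theta>" "obedient \<Theta> x p"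
  shows "\<exists>g. efficient_split \<Theta> x p g"
  using assms(4,5)
proof (induction "card {\<theta> \<in> \<Theta>. 0 < x \<theta>}" arbitrary: x rule: less_induct)
  case less
  let ?S = "{\<theta> \<in> \<Theta>. 0 < x \<theta>}"
  have fS: "finite ?S" using assms(1) by simp
  have x0: "\<forall>\<theta>\<in>\<Theta> - ?S. x \<theta> = 0" using less.prems(1) by force
  consider "?S = {}" | "0 \<in> ?S" | "?S \<noteq> {}" "0 \<notin> ?S" by blast
  then show ?case
  proof cases
    case 1
    have "x \<theta> = 0" if "\<theta> \<in> \<Theta>" for \<theta> using x0 that unfolding 1 by simp
    then have "efficient_split \<Theta> x p (\<lambda>_ _. 0)"
      by (simp add: efficient_split_def obedient_def revenue_zero)
    then show ?thesis by blast
  next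
    case 2
    let ?y = "x(0 := 0)"
    let ?z = "\<lambda>\<theta>. if \<theta> = 0 then x 0 else 0"
    have "{\<theta> \<in> \<Theta>. 0 < ?y \<theta>} = ?S - {0}" by auto
    with 2 fS have "card {\<theta> \<in> \<Theta>. 0 < ?y \<theta>} < card ?S" by (metis card_Diff1_less)
    moreover have "obedient \<Theta> ?y p"
      using less.prems(2) assms(2,3) by (simp add: obedient_def revenue_fun_upd_zero)
    ultimately have "\<exists>g. efficient_split \<Theta> ?y p g"
      by (intro less.hyps) (auto simp: less.prems(1))
    then obtain g where g: "efficient_split \<Theta> ?y p g" ..
    \<comment> \<open>All mass of \<open>?z\<close> is at type 0, so every price earns nothing and
      price 0 is trivially optimal.\<close>
    have "revenue \<Theta> ?z q = 0" if "q \<in> \<Theta>" for q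
      using that assms(2) by (cases "q = 0") (auto simp: revenue_def subset_eq intro!: sum.neutral)
    then have "obedient \<Theta> ?z 0" using 2 by (auto simp: obedient_def)
    then have "efficient_split \<Theta> (\<lambda>\<theta>. ?y \<theta> + ?z \<theta>) p
        (\<lambda>\<theta> q. g \<theta> q + (if q = 0 then ?z \<theta> else 0))"
      by (intro efficient_split_add_segment assms(1) g) (use 2 assms(2,3) in \<open>auto split: if_splits\<close>)
    moreover have "(\<lambda>\<theta>. ?y \<theta> + ?z \<theta>) = x" by auto
    ultimately show ?thesis by auto
  next
    case 3
    have pos: "0 < s" if "s \<in> ?S" for s
    proof -
      have "s \<noteq> 0" "0 \<le> s" using that 3 assms(2) by auto
      then show ?thesis by simp
    qed
    then have "?S \<subseteq> {0<..}" by blast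
    from equal_revenue_market[OF fS this] obtain e where e: "\<And>s. s \<in> ?S \<Longrightarrow> 0 < e s"
      "\<And>s. s \<notin> ?S \<Longrightarrow> e s = 0" "\<And>s. s \<in> ?S \<Longrightarrow> revenue ?S e s = 1"
      by blast
    have e0: "0 \<le> e \<theta>" for \<theta> using e(1,2)[of \<theta>] by fastforce
    have "revenue ?S e q = revenue \<Theta> e q" for q
      unfolding revenue_def
      by (intro arg_cong2[where f = "(*)"] sum.mono_neutral_left) (use assms(1) e(2) in auto)
    with e(3) have e1: "revenue \<Theta> e s = 1" if "s \<in> ?S" for s using that by simp
    \<comment> \<open>For markets supported on \<open>?S\<close>, a bound on revenue has only to be
      checked at prices in \<open>?S\<close>: raising a price to the next element of
      \<open>?S\<close> keeps demand. Prices with zero revenue are covered by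
      \<open>0 \<le> c\<close>. This serves both the remainder and the market
      \<open>e\<close>.\<close>
    have next_le: "revenue \<Theta> z q \<le> c"
      if z: "\<And>\<theta>. \<theta> \<in> \<Theta> \<Longrightarrow> 0 \<le> z \<theta>" "\<forall>\<theta>\<in>\<Theta> - ?S. z \<theta> = 0"
        and c: "0 \<le> c" "\<And>s. s \<in> ?S \<Longrightarrow> revenue \<Theta> z s \<le> c" for z q c
    proof (cases "revenue \<Theta> z q = 0")
      case True
      then show ?thesis using c by simp
    next
      case False
      obtain s where s: "s \<in> ?S" "q \<le> s" "q * revenue \<Theta> z s = s * revenue \<Theta> z q"
        by (rule revenue_next_support[where S = ?S and x = z,
              OF assms(1) Collect_restrict z(2) False])
      have "s * revenue \<Theta> z q \<le> s * revenue \<Theta> z s"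
        unfolding s(3)[symmetric] using s(2) pos[OF s(1)]
        by (intro mult_right_mono revenue_nonneg z(1)) simp_all
      then have "revenue \<Theta> z q \<le> revenue \<Theta> z s" using pos[OF s(1)] by simp
      also have "\<dots> \<le> c" by (rule c(2)[OF s(1)])
      finally show ?thesis .
    qed
    \<comment> \<open>Otherwise the next supported type would face the same demand at a strictly
      higher price, contradicting optimality of \<open>p\<close>. Membership is what makes the
      subtraction below lower the revenue of \<open>p\<close> by exactly \<open>\<alpha>\<close>,
      and it gives \<open>m \<le> p\<close>.\<close>
    have "p \<in> ?S"
    proof -
      have M: "Max ?S \<in> ?S" using 3 fS Max_in by blast
      have "0 < (\<Sum>\<theta> | \<theta> \<in> \<Theta> \<and> \<theta> \<ge> Max ?S. x \<theta>)"
        by (rule sum_pos2[of _ "Max ?S"]) (use M assms(1) less.prems(1) in auto)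
      then have "0 < revenue \<Theta> x (Max ?S)"
        using pos[OF M] by (simp add: revenue_def)
      also have "\<dots> \<le> revenue \<Theta> x p" using M less.prems(2) by (auto simp: obedient_def)
      finally have r: "0 < revenue \<Theta> x p" .
      from r have "revenue \<Theta> x p \<noteq> 0" by simp
      then obtain s where s: "s \<in> ?S" "p \<le> s" "p * revenue \<Theta> x s = s * revenue \<Theta> x p"
        by (rule revenue_next_support[where S = ?S and x = x,
              OF assms(1) Collect_restrict x0])
      have "p * revenue \<Theta> x s \<le> p * revenue \<Theta> x p"
        using s(1) assms(2,3) less.prems(2) by (intro mult_left_mono) (auto simp: obedient_def)
      with s(3) r have "s \<le> p" by simp
      with s show ?thesis by auto
    qed
    define m where "m = Min ?S"
    have m: "m \<in> ?S" unfolding m_def by (rule Min_in[OF fS 3(1)])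
    have m_le: "m \<le> s" if "s \<in> ?S" for s unfolding m_def by (rule Min_le[OF fS that])
    \<comment> \<open>The largest multiple of \<open>e\<close> that fits below \<open>x\<close>. The
      minimum is attained at some \<open>s0\<close>, whose mass is used up completely, so the
      support shrinks.\<close>
    define \<alpha> where "\<alpha> = Min ((\<lambda>s. x s / e s) ` ?S)"
    have "\<alpha> \<in> (\<lambda>s. x s / e s) ` ?S" unfolding \<alpha>_def using 3 fS by (intro Min_in) auto
    then obtain s0 where s0: "s0 \<in> ?S" "\<alpha> = x s0 / e s0" by blast
    have \<alpha>: "0 < \<alpha>" using s0 e(1)[OF s0(1)] by simp
    have le: "\<alpha> * e s \<le> x s" if "s \<in> ?S" for s
    proof -
      have "\<alpha> \<le> x s / e s" unfolding \<alpha>_def using fS that by (intro Min_le) auto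
      then show ?thesis using e(1)[OF that] by (simp add: pos_le_divide_eq)
    qed
    let ?z = "\<lambda>\<theta>. \<alpha> * e \<theta>"
    let ?y = "\<lambda>\<theta>. x \<theta> - ?z \<theta>"
    have y0: "0 \<le> ?y \<theta>" if "\<theta> \<in> \<Theta>" for \<theta>
      using le[of \<theta>] e(2)[of \<theta>] less.prems(1)[OF that] by (cases "\<theta> \<in> ?S") auto
    have yS: "\<forall>\<theta>\<in>\<Theta> - ?S. ?y \<theta> = 0"
    proof
      fix \<theta> assume \<theta>: "\<theta> \<in> \<Theta> - ?S"
      then have "e \<theta> = 0" by (intro e(2)) blast
      with bspec[OF x0 \<theta>] show "?y \<theta> = 0" by simp
    qed
    have "{\<theta> \<in> \<Theta>. 0 < ?y \<theta>} \<subseteq> ?S - {s0}"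
    proof
      fix \<theta> assume \<theta>: "\<theta> \<in> {\<theta> \<in> \<Theta>. 0 < ?y \<theta>}"
      have "?y s0 = 0" using s0(2) e(1)[OF s0(1)] by simp
      with \<theta> have "\<theta> \<noteq> s0" by auto
      moreover have "\<theta> \<in> ?S"
      proof (rule ccontr)
        assume "\<theta> \<notin> ?S"
        with \<theta> have "\<theta> \<in> \<Theta> - ?S" by blast
        from bspec[OF yS this] \<theta> show False by simp
      qed
      ultimately show "\<theta> \<in> ?S - {s0}" by blast
    qed
    then have "card {\<theta> \<in> \<Theta>. 0 < ?y \<theta>} < card ?S"
      using fS s0(1) by (intro psubset_card_mono) auto
    \<comment> \<open>All prices in \<open>?S\<close>, including \<open>p\<close>, lose revenue
      \<open>\<alpha>\<close>, so \<open>p\<close> remains best within \<open>?S\<close>;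
      \<open>next_le\<close> extends this to all prices.\<close>
    moreover have "obedient \<Theta> ?y p"
      unfolding obedient_def
    proof
      fix q
      show "revenue \<Theta> ?y q \<le> revenue \<Theta> ?y p"
      proof (rule next_le[OF y0 yS])
        show "0 \<le> revenue \<Theta> ?y p" using assms(2,3) by (intro revenue_nonneg y0) auto
        show "revenue \<Theta> ?y s \<le> revenue \<Theta> ?y p" if "s \<in> ?S" for s
          using that less.prems(2) e1[OF that] e1[OF \<open>p \<in> ?S\<close>]
          by (simp add: revenue_diff revenue_scale obedient_def)
      qed
    qed
    ultimately have "\<exists>g. efficient_split \<Theta> ?y p g"
      by (intro less.hyps y0)
    then obtain g where g: "efficient_split \<Theta> ?y p g" ..
    \<comment> \<open>Every price in \<open>?S\<close> is optimal for \<open>e\<close>. The lowest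
      one is selected because all types in \<open>?S\<close> then buy.\<close>
    have "obedient \<Theta> e m"
      unfolding obedient_def e1[OF m]
    proof (rule ballI, rule next_le[OF e0])
      show "\<forall>\<theta>\<in>\<Theta> - ?S. e \<theta> = 0" using e(2) by blast
      show "revenue \<Theta> e s \<le> 1" if "s \<in> ?S" for s using e1[OF that] by simp
    qed simp
    then have "obedient \<Theta> ?z m"
      using \<alpha> by (simp add: obedient_def revenue_scale)
    moreover have "\<theta> \<in> ?S" if "?z \<theta> \<noteq> 0" for \<theta> using e(2)[of \<theta>] that by fastforce
    moreover have "m \<in> \<Theta>" "m \<le> p" using m m_le[OF \<open>p \<in> ?S\<close>] by simp_all
    moreover have "0 \<le> ?z \<theta>" for \<theta> using \<alpha> e0[of \<theta>] by simp
    ultimately have "efficient_split \<Theta> (\<lambda>\<theta>. ?y \<theta> + ?z \<theta>) p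
        (\<lambda>\<theta> q. g \<theta> q + (if q = m then ?z \<theta> else 0))"
      by (intro efficient_split_add_segment assms(1) g) (use m_le in blast)+
    then show ?thesis by auto
  qed
qed

section \<open>Segmentations as a compact set of functions\<close>

text \<open>Segmentations are handled as real functions, which can be added pointwise and carry the
  product topology. Requiring value 0 off \<open>\<Theta> \<times> \<Theta>\<close> makes the set
  bounded in every coordinate.\<close>

definition feasible :: "real set \<Rightarrow> (real \<Rightarrow> real) \<Rightarrow> (real \<times> real \<Rightarrow> real) set"
  where "feasible \<Theta> m =
    {f. (\<forall>z. 0 \<le> f z) \<and> (\<forall>z. z \<notin> \<Theta> \<times> \<Theta> \<longrightarrow> f z = 0) \<and>
        (\<forall>\<theta>\<in>\<Theta>. (\<Sum>p\<in>\<Theta>. f (\<theta>, p)) = m \<theta>) \<and>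
        (\<forall>p\<in>\<Theta>. obedient \<Theta> (\<lambda>\<theta>. f (\<theta>, p)) p)}"

lemma segmentations_iff_feasible:
  "\<sigma> \<in> segmentations \<Theta> \<mu> \<longleftrightarrow> pmf \<sigma> \<in> feasible \<Theta> (pmf \<mu>)"
proof -
  have "set_pmf \<sigma> \<subseteq> \<Theta> \<times> \<Theta> \<longleftrightarrow> (\<forall>z. z \<notin> \<Theta> \<times> \<Theta> \<longrightarrow> pmf \<sigma> z = 0)"
    unfolding set_pmf_eq by blast
  then show ?thesis
    by (simp only: segmentations_def feasible_def dists_def obedient_def revenue_def
        mem_Collect_eq pmf_nonneg simp_thms)
qed

text \<open>The total mass is 1 because the type marginal is \<open>\<mu>\<close>, which lives on
  \<open>\<Theta>\<close>.\<close>

lemma feasible_is_pmf: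
  assumes "finite \<Theta>" "\<mu> \<in> dists \<Theta>" "f \<in> feasible \<Theta> (pmf \<mu>)"
  obtains \<sigma> where "pmf \<sigma> = f"
proof -
  have nn: "0 \<le> f z" and out: "z \<notin> \<Theta> \<times> \<Theta> \<Longrightarrow> f z = 0" for z
    using assms(3) unfolding feasible_def by blast+
  have "(\<integral>\<^sup>+ z. ennreal (f z) \<partial>count_space UNIV) = (\<Sum>z\<in>\<Theta> \<times> \<Theta>. ennreal (f z))"
    by (rule nn_integral_count_space') (use assms(1) out in auto)
  also have "\<dots> = ennreal (\<Sum>z\<in>\<Theta> \<times> \<Theta>. f z)" using nn by simp
  also have "(\<Sum>z\<in>\<Theta> \<times> \<Theta>. f z) = (\<Sum>\<theta>\<in>\<Theta>. \<Sum>p\<in>\<Theta>. f (\<theta>, p))"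
    by (simp add: sum.cartesian_product)
  also have "\<dots> = (\<Sum>\<theta>\<in>\<Theta>. pmf \<mu> \<theta>)"
    using assms(3) by (simp add: feasible_def)
  also have "\<dots> = 1" using assms by (intro sum_pmf_eq_1) (auto simp: dists_def)
  finally have "pmf (embed_pmf f) = f" using nn by (intro ext pmf_embed_pmf) auto
  then show thesis by (rule that)
qed

text \<open>The set is closed, being cut out by equations and weak inequalities between continuous
  functions of the coordinates. It lies in a product of compact intervals, since a nonnegative entry
  is at most its row sum \<open>m \<theta>\<close>; this box is compact by Tychonoff.\<close>

lemma compact_feasible:
  assumes "finite \<Theta>"
  shows "compact (feasible \<Theta> m)"
proof -
  let ?B = "\<lambda>z. if z \<in> \<Theta> \<times> \<Theta> then {0..m (fst z)} else {0}"
  have "compactin (product_topology (\<lambda>_. euclidean) UNIV) (PiE UNIV ?B)"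
    by (subst compactin_PiE) auto
  then have "compact (PiE UNIV ?B)"
    by (simp add: euclidean_product_topology)
  moreover have "closed (feasible \<Theta> m)"
    unfolding feasible_def obedient_def revenue_def Ball_def
    by (intro closed_Collect_conj closed_Collect_all closed_Collect_imp closed_Collect_le
        closed_Collect_eq open_Collect_const continuous_intros
        continuous_on_product_coordinates)
  moreover have sub: "feasible \<Theta> m \<subseteq> PiE UNIV ?B"
  proof
    fix f assume f: "f \<in> feasible \<Theta> m"
    have "f (\<theta>, p) \<le> m \<theta>" if "\<theta> \<in> \<Theta>" "p \<in> \<Theta>" for \<theta> p
      using f that assms member_le_sum[of p \<Theta> "\<lambda>p. f (\<theta>, p)"] by (auto simp: feasible_def)
    with f show "f \<in> PiE UNIV ?B" by (auto simp: feasible_def)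
  qed
  ultimately have "compact (PiE UNIV ?B \<inter> feasible \<Theta> m)" by (intro compact_Int_closed)
  then show ?thesis unfolding inf.absorb2[OF sub] .
qed

text \<open>Supplies nonemptiness for the existence of a maximum. In the segment of type
  \<open>p\<close> a price \<open>q\<close> sells only if \<open>q \<le> p\<close>, so charging
  \<open>p\<close> itself is optimal.\<close>

lemma perfect_discrimination_feasible:
  assumes "finite \<Theta>" "\<Theta> \<subseteq> {0..}" "\<mu> \<in> dists \<Theta>"
  shows "(\<lambda>(\<theta>, p). if \<theta> = p then pmf \<mu> \<theta> else 0) \<in> feasible \<Theta> (pmf \<mu>)"
proof -
  have r: "revenue \<Theta> (\<lambda>\<theta>. if \<theta> = p then pmf \<mu> \<theta> else 0) q = (if q \<le> p then q * pmf \<mu> p else 0)"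
    if "p \<in> \<Theta>" for p q
    using assms(1) that by (simp add: revenue_def)
  have "obedient \<Theta> (\<lambda>\<theta>. if \<theta> = p then pmf \<mu> \<theta> else 0) p" if "p \<in> \<Theta>" for p
    using that assms(2) by (auto simp: obedient_def r intro!: mult_right_mono)
  then show ?thesis
    using assms by (auto simp: feasible_def dists_def set_pmf_eq)
qed

section \<open>Efficient segmentations do at least as well\<close>

text \<open>Every segment is split efficiently, and the pieces that carry the same new price are
  merged. Buyers only move to prices that are no higher and at which they trade.\<close>

lemma efficient_improvement:
  assumes "finite \<Theta>" "\<Theta> \<subseteq> {0..}" "w \<in> redistributive \<Theta>" "f \<in> feasible \<Theta> m"
  obtains h where "h \<in> feasible \<Theta> m" "\<And>z. h z \<noteq> 0 \<Longrightarrow> z \<in> trade_pairs \<Theta>"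
    "(\<Sum>(\<theta>, p)\<in>\<Theta> \<times> \<Theta>. w \<theta> p * f (\<theta>, p)) \<le> (\<Sum>(\<theta>, p)\<in>\<Theta> \<times> \<Theta>. w \<theta> p * h (\<theta>, p))"
proof -
  have "\<forall>p\<in>\<Theta>. \<exists>g. efficient_split \<Theta> (\<lambda>\<theta>. f (\<theta>, p)) p g"
    using assms by (intro ballI efficient_split_exists) (auto simp: feasible_def)
  from bchoice[OF this] obtain G where
    G: "\<And>p. p \<in> \<Theta> \<Longrightarrow> efficient_split \<Theta> (\<lambda>\<theta>. f (\<theta>, p)) p (G p)"
    by blast
  have G0: "0 \<le> G p \<theta> q" if "p \<in> \<Theta>" for p \<theta> q
    using G[OF that] unfolding efficient_split_def by blast
  have Gs: "(\<Sum>q\<in>\<Theta>. G p \<theta> q) = f (\<theta>, p)" if "p \<in> \<Theta>" "\<theta> \<in> \<Theta>" for p \<theta>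
    using G[OF that(1)] that(2) unfolding efficient_split_def by blast
  have supp: "\<theta> \<in> \<Theta> \<and> q \<in> \<Theta> \<and> q \<le> \<theta> \<and> q \<le> p" if "p \<in> \<Theta>" "G p \<theta> q \<noteq> 0" for p \<theta> q
    using G[OF that(1)] that(2) unfolding efficient_split_def by blast
  define h where "h = (\<lambda>(\<theta>, q). \<Sum>p\<in>\<Theta>. G p \<theta> q)"
  have h_supp: "z \<in> trade_pairs \<Theta>" if "h z \<noteq> 0" for z
  proof -
    obtain \<theta> q where z: "z = (\<theta>, q)" by force
    with that obtain p where "p \<in> \<Theta>" "G p \<theta> q \<noteq> 0"
      by (auto simp: h_def elim: sum.not_neutral_contains_not_neutral)
    from supp[OF this] z show ?thesis by (auto simp: trade_pairs_def)
  qed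
  show thesis
  proof (rule that[of h])
    have "0 \<le> h z" for z
      by (auto simp: h_def G0 split: prod.split intro!: sum_nonneg)
    moreover have "h z = 0" if "z \<notin> \<Theta> \<times> \<Theta>" for z
      using h_supp[of z] that by (auto simp: trade_pairs_def)
    moreover have "(\<Sum>q\<in>\<Theta>. h (\<theta>, q)) = m \<theta>" if "\<theta> \<in> \<Theta>" for \<theta>
    proof -
      have "(\<Sum>q\<in>\<Theta>. h (\<theta>, q)) = (\<Sum>p\<in>\<Theta>. \<Sum>q\<in>\<Theta>. G p \<theta> q)"
        unfolding h_def prod.case by (rule sum.swap)
      also have "\<dots> = m \<theta>" using assms(4) that Gs by (simp add: feasible_def)
      finally show ?thesis .
    qed
    moreover have "obedient \<Theta> (\<lambda>\<theta>. h (\<theta>, q)) q" if "q \<in> \<Theta>" for q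
      unfolding h_def prod.case
    proof (rule obedient_sum)
      show "obedient \<Theta> (\<lambda>\<theta>. G p \<theta> q) q" if "p \<in> \<Theta>" for p
        using G[OF that] \<open>q \<in> \<Theta>\<close> unfolding efficient_split_def by blast
    qed
    ultimately show "h \<in> feasible \<Theta> m" by (auto simp: feasible_def)
  next
    show "z \<in> trade_pairs \<Theta>" if "h z \<noteq> 0" for z using h_supp that .
  next
    \<comment> \<open>\<open>G p \<theta> q\<close> is the mass of type \<open>\<theta>\<close>
      moved from price \<open>p\<close> to price \<open>q\<close>. Both welfare sums expand over
      these triples, so a comparison term by term suffices.\<close>
    have le: "w \<theta> p * G p \<theta> q \<le> w \<theta> q * G p \<theta> q" if t: "p \<in> \<Theta>" "\<theta> \<in> \<Theta>" for p \<theta> q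
    proof (cases "G p \<theta> q = 0")
      case False
      note s = supp[OF t(1) this]
      have "w \<theta> p \<le> w \<theta> q"
      \<comment> \<open>Without trade at \<open>p\<close> the old weight is 0 and the new one is
        nonnegative; with trade, both prices lie in the range where \<open>w \<theta>\<close> is
        antimonotone.\<close>
      proof (cases "\<theta> < p")
        case True
        then show ?thesis using assms(3) s t by (auto simp: redistributive_def)
      next
        case False
        moreover have "antimono_on {p \<in> \<Theta>. p \<le> \<theta>} (w \<theta>)"
          using assms(3) t by (auto simp: redistributive_def)
        ultimately show ?thesis using s t by (auto simp: monotone_on_def)
      qed
      then show ?thesis using G0[OF t(1)] by (rule mult_right_mono)
    qed simp
    have "(\<Sum>(\<theta>, p)\<in>\<Theta> \<times> \<Theta>. w \<theta> p * f (\<theta>, p)) = (\<Sum>\<theta>\<in>\<Theta>. \<Sum>p\<in>\<Theta>. \<Sum>q\<in>\<Theta>. w \<theta> p * G p \<theta> q)"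
      unfolding sum.cartesian_product[symmetric]
      by (intro sum.cong refl) (simp add: Gs sum_distrib_left[symmetric])
    also have "\<dots> \<le> (\<Sum>\<theta>\<in>\<Theta>. \<Sum>p\<in>\<Theta>. \<Sum>q\<in>\<Theta>. w \<theta> q * G p \<theta> q)"
      by (intro sum_mono le)
    also have "\<dots> = (\<Sum>\<theta>\<in>\<Theta>. \<Sum>q\<in>\<Theta>. \<Sum>p\<in>\<Theta>. w \<theta> q * G p \<theta> q)"
      by (intro sum.cong refl sum.swap)
    also have "\<dots> = (\<Sum>(\<theta>, p)\<in>\<Theta> \<times> \<Theta>. w \<theta> p * h (\<theta>, p))"
      by (simp add: h_def sum.cartesian_product[symmetric] sum_distrib_left)
    finally show "(\<Sum>(\<theta>, p)\<in>\<Theta> \<times> \<Theta>. w \<theta> p * f (\<theta>, p)) \<le>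
        (\<Sum>(\<theta>, p)\<in>\<Theta> \<times> \<Theta>. w \<theta> p * h (\<theta>, p))" .
  qed
qed

theorem lemma1:
  fixes \<Theta> :: "real set" and w :: "real \<Rightarrow> real \<Rightarrow> real" and \<mu> :: "real pmf"
  assumes "finite \<Theta>" and "\<Theta> \<subseteq> {0..}"
    and "w \<in> redistributive \<Theta>"
    and "\<mu> \<in> dists \<Theta>" and "\<forall>\<theta>\<in>\<Theta>. pmf \<mu> \<theta> > 0"
  shows "\<exists>\<sigma>\<in>efficient_segmentations \<Theta> \<mu>.
           \<forall>\<sigma>'\<in>segmentations \<Theta> \<mu>. welfare \<Theta> w \<sigma>' \<le> welfare \<Theta> w \<sigma>"
proof -
  let ?F = "feasible \<Theta> (pmf \<mu>)"
  let ?W = "\<lambda>f. \<Sum>(\<theta>, p)\<in>\<Theta> \<times> \<Theta>. w \<theta> p * f (\<theta>, p)"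
  have "continuous_on ?F ?W"
    unfolding case_prod_unfold
    by (intro continuous_intros continuous_on_product_coordinates[THEN continuous_on_subset]) auto
  then obtain f where f: "f \<in> ?F" "\<And>f'. f' \<in> ?F \<Longrightarrow> ?W f' \<le> ?W f"
    using continuous_attains_sup[OF compact_feasible[OF assms(1)]]
      perfect_discrimination_feasible[OF assms(1,2,4)] by blast
  \<comment> \<open>Being feasible and at least as good as the maximizer \<open>f\<close>, the
    function \<open>h\<close> is a maximizer too.\<close>
  obtain h where h: "h \<in> ?F" "\<And>z. h z \<noteq> 0 \<Longrightarrow> z \<in> trade_pairs \<Theta>" "?W f \<le> ?W h"
    using efficient_improvement[OF assms(1-3) f(1)] by blast
  obtain \<sigma> where \<sigma>: "pmf \<sigma> = h" using feasible_is_pmf[OF assms(1,4) h(1)] .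
  show ?thesis
  proof (intro bexI ballI)
    show "\<sigma> \<in> efficient_segmentations \<Theta> \<mu>"
      using h \<sigma> by (auto simp: efficient_segmentations_def segmentations_iff_feasible
          set_pmf_eq)
    show "welfare \<Theta> w \<sigma>' \<le> welfare \<Theta> w \<sigma>" if "\<sigma>' \<in> segmentations \<Theta> \<mu>" for \<sigma>'
      using f(2)[of "pmf \<sigma>'"] h(3) that
      by (simp add: welfare_def \<sigma> segmentations_iff_feasible)
  qed
qed

end
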